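(* Let $\mathcal{X}=[m]$ with $m\ge2$ and let $(\mathcal{X},\mathcal{E})$ be a strongly connected directed graph with $\mathcal{E}$ symmetric, i.e. $(x,x')\in\mathcal{E}\iff(x',x)\in\mathcal{E}$. Then: (i) The set of reversible generators $\mathcal{G}_{\mathsf{rev}}(\mathcal{X},\mathcal{E})=\mathcal{F}_{\mathsf{rev}}(\mathcal{X},\mathcal{E})/\mathcal{N}(\mathcal{X},\mathcal{E})$ is endowed with a vector space structure of dimension $|T(\mathcal{E})|$. (ii) The set $\mathcal{W}_{\mathsf{rev}}(\mathcal{X},\mathcal{E})$ of irreducible and reversible Markov kernels over $(\mathcal{X},\mathcal{E})$ forms an e-family of dimension $\dim\mathcal{W}_{\mathsf{rev}}(\mathcal{X},\mathcal{E})=|T(\mathcal{E})|$.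
   Context: $T(\mathcal{E})=\{(x,x')\in\mathcal{E}: x'\le x,\ (x,x')\ne(m,x_\star)\}$ with $x_\star=\min\{x\in\mathcal{X}:(m,x)\in\mathcal{E}\}$; one has $|T(\mathcal{E})|=\frac{|\mathcal{E}|+|T_0(\mathcal{E})|}{2}-1$ with $T_0(\mathcal{E})=\{(x,x')\in\mathcal{E}:x=x'\}$. $\mathcal{F}(\mathcal{X},\mathcal{E})$: real functions on $\mathcal{X}^2$ vanishing outside $\mathcal{E}$. $\mathcal{N}(\mathcal{X},\mathcal{E})$: those $h\in\mathcal{F}(\mathcal{X},\mathcal{E})$ for which there are $c\in\mathbb{R}$, $f\in\mathbb{R}^{\mathcal{X}}$ with $h(x,x')=f(x')-f(x)+c$ for all $(x,x')\in\mathcal{E}$. $\mathcal{F}_{\mathsf{rev}}(\mathcal{X},\mathcal{E})$: log-reversible $h\in\mathcal{F}(\mathcal{X},\mathcal{E})$, i.e. for every finite directed closed path $(x_1,x_2),\dots,(x_n,x_{n+1})$ of edges in $\mathcal{E}$ with $x_{n+1}=x_1$ (vertices may repeat), $\sum_{t=1}^nh(x_t,x_{t+1})=\sum_{t=1}^nh(x_{t+1},x_t)$. $\mathcal{W}(\mathcal{X},\mathcal{E})$: row-stochastic matrices $P$ on $\mathcal{X}$ with $P(x,x')>0$ exactly for $(x,x')\in\mathcal{E}$; such $P$ has a unique stationary distribution $\pi>0$. $\mathcal{W}_{\mathsf{rev}}(\mathcal{X},\mathcal{E})$: those $P\in\mathcal{W}(\mathcal{X},\mathcal{E})$ with $\pi(x)P(x,x')=\pi(x')P(x',x)$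 for all $x,x'$. A subset of $\mathcal{W}(\mathcal{X},\mathcal{E})$ is an e-family of dimension $d$ if it can be written $\{P_\theta:\theta\in\Theta\}$ with $\Theta\subset\mathbb{R}^d$ connected and containing an open ball centered at $0$, and there are $K,g_1,\dots,g_d:\mathcal{X}^2\to\mathbb{R}$, $R:\Theta\times\mathcal{X}\to\mathbb{R}$, $\psi:\Theta\to\mathbb{R}$ such that $\log P_\theta(x,x')=K(x,x')+\sum_{i=1}^d\theta^ig_i(x,x')+R(\theta,x')-R(\theta,x)-\psi(\theta)$ for $(x,x')\in\mathcal{E}$ and $P_\theta(x,x')=0$ otherwise, where $g_1,\dots,g_d$ (restricted to $\mathcal{E}$) are linearly independent modulo $\mathcal{N}(\mathcal{X},\mathcal{E})$. *)

theory Defs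
  imports "HOL-Analysis.Analysis" "HOL-Algebra.AbelCoset" "Jordan_Normal_Form.VS_Connect"
begin

text \<open>
  The state space is \<open>{1..m}\<close> and an edge set is a relation \<open>E \<subseteq> {1..m} \<times> {1..m}\<close>.
  Functions and matrices on \<open>{1..m} \<times> {1..m}\<close> that vanish off \<open>E\<close> are represented by functions
  \<open>nat \<times> nat \<Rightarrow> real\<close> that vanish off \<open>E\<close>, so each of them has exactly one representative.
\<close>

definition strongly_connected_digraph :: "nat \<Rightarrow> (nat \<times> nat) set \<Rightarrow> bool" where
  "strongly_connected_digraph m E \<longleftrightarrow>
     E \<subseteq> {1..m} \<times> {1..m} \<and> (\<forall>x\<in>{1..m}. \<forall>y\<in>{1..m}. (x, y) \<in> E\<^sup>*)"

definition x_star :: "nat \<Rightarrow> (nat \<times> nat) set \<Rightarrow> nat" where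
  "x_star m E = Min {x \<in> {1..m}. (m, x) \<in> E}"

definition T_set :: "nat \<Rightarrow> (nat \<times> nat) set \<Rightarrow> (nat \<times> nat) set" where
  "T_set m E = {(x, x'). (x, x') \<in> E \<and> x' \<le> x \<and> (x, x') \<noteq> (m, x_star m E)}"


subsection \<open>Functions on the edges and generators\<close>

definition edge_funs :: "(nat \<times> nat) set \<Rightarrow> (nat \<times> nat \<Rightarrow> real) set" where
  "edge_funs E = {h. \<forall>e. e \<notin> E \<longrightarrow> h e = 0}"

definition null_funs :: "(nat \<times> nat) set \<Rightarrow> (nat \<times> nat \<Rightarrow> real) set" where
  "null_funs E = {h \<in> edge_funs E.
     \<exists>(c :: real) (f :: nat \<Rightarrow> real). \<forall>(x, x') \<in> E. h (x, x') = f x' - f x + c}"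

text \<open>
  A closed path with \<open>n\<close> edges is given by its vertices \<open>p 1, \<dots>, p (n + 1) = p 1\<close>; the values of \<open>p\<close>
  at other indices are irrelevant.
\<close>

definition closed_path :: "(nat \<times> nat) set \<Rightarrow> nat \<Rightarrow> (nat \<Rightarrow> nat) \<Rightarrow> bool" where
  "closed_path E n p \<longleftrightarrow> (\<forall>t\<in>{1..n}. (p t, p (t + 1)) \<in> E) \<and> p (n + 1) = p 1"

definition log_reversible :: "(nat \<times> nat) set \<Rightarrow> (nat \<times> nat \<Rightarrow> real) \<Rightarrow> bool" where
  "log_reversible E h \<longleftrightarrow>
     (\<forall>n\<ge>1. \<forall>p. closed_path E n p \<longrightarrow>
        (\<Sum>t=1..n. h (p t, p (t + 1))) = (\<Sum>t=1..n. h (p (t + 1), p t)))"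

definition rev_funs :: "(nat \<times> nat) set \<Rightarrow> (nat \<times> nat \<Rightarrow> real) set" where
  "rev_funs E = {h \<in> edge_funs E. log_reversible E h}"

text \<open>
  Modules are records that extend rings, but no module axiom mentions \<open>mult\<close> and \<open>one\<close>; these two
  fields are filled with dummies in the following two definitions.
\<close>

definition fun_space :: "(nat \<times> nat \<Rightarrow> real) set \<Rightarrow> (real, nat \<times> nat \<Rightarrow> real) module" where
  "fun_space H =
     \<lparr>carrier = H,
      mult = (\<lambda>g h. (\<lambda>_. 0)),
      one = (\<lambda>_. 0),
      zero = (\<lambda>_. 0),
      add = (\<lambda>g h e. g e + h e),
      smult = (\<lambda>c h e. c * h e)\<rparr>"

text \<open>
  Scalar multiplication on cosets is \<open>c (N + h) = N + c h\<close>. The union below runs over all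
  representatives \<open>h\<close> of the coset \<open>A\<close>, and all its members are equal if \<open>N\<close> is a subspace.
\<close>

definition quotient_space :: "('a, 'b, 'c) module_scheme \<Rightarrow> 'b set \<Rightarrow> ('a, 'b set) module" where
  "quotient_space V N =
     \<lparr>carrier = a_rcosets\<^bsub>V\<^esub> N,
      mult = (\<lambda>A B. N),
      one = N,
      zero = N,
      add = (\<lambda>A B. A <+>\<^bsub>V\<^esub> B),
      smult = (\<lambda>c A. \<Union>h\<in>A. N +>\<^bsub>V\<^esub> (c \<odot>\<^bsub>V\<^esub> h))\<rparr>"

definition G_rev :: "(nat \<times> nat) set \<Rightarrow> (real, (nat \<times> nat \<Rightarrow> real) set) module" where
  "G_rev E = quotient_space (fun_space (rev_funs E)) (null_funs E)"


subsection \<open>Markov kernels\<close>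

definition kernels :: "nat \<Rightarrow> (nat \<times> nat) set \<Rightarrow> (nat \<times> nat \<Rightarrow> real) set" where
  "kernels m E = {P. (\<forall>e\<in>E. P e > 0) \<and> (\<forall>e. e \<notin> E \<longrightarrow> P e = 0) \<and>
                     (\<forall>x\<in>{1..m}. (\<Sum>x'=1..m. P (x, x')) = 1)}"

definition stationary_distribution :: "nat \<Rightarrow> (nat \<times> nat \<Rightarrow> real) \<Rightarrow> (nat \<Rightarrow> real) \<Rightarrow> bool" where
  "stationary_distribution m P \<pi> \<longleftrightarrow>
     (\<forall>x\<in>{1..m}. \<pi> x \<ge> 0) \<and> (\<Sum>x=1..m. \<pi> x) = 1 \<and>
     (\<forall>x'\<in>{1..m}. (\<Sum>x=1..m. \<pi> x * P (x, x')) = \<pi> x')"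

text \<open>
  On a strongly connected graph the stationary distribution \<open>\<pi>\<close> of \<open>P \<in> kernels m E\<close> exists and is
  unique (as a function on \<open>{1..m}\<close>), so the \<open>\<pi>\<close> in the next definition is the stationary
  distribution of \<open>P\<close>.
\<close>

definition rev_kernels :: "nat \<Rightarrow> (nat \<times> nat) set \<Rightarrow> (nat \<times> nat \<Rightarrow> real) set" where
  "rev_kernels m E = {P \<in> kernels m E.
     \<exists>\<pi>. stationary_distribution m P \<pi> \<and>
         (\<forall>x\<in>{1..m}. \<forall>x'\<in>{1..m}. \<pi> x * P (x, x') = \<pi> x' * P (x', x))}"


subsection \<open>Exponential families\<close>

text \<open>
  A point of $\mathbb{R}^d$ is an element of \<open>topspace (Euclidean_space d)\<close>, i.e. a sequence
  \<open>nat \<Rightarrow> real\<close> that vanishes at all indices \<open>i \<ge> d\<close>; its coordinates have the indices \<open>i < d\<close>.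
\<close>

definition lin_indep_mod_null ::
    "(nat \<times> nat) set \<Rightarrow> nat \<Rightarrow> (nat \<Rightarrow> nat \<times> nat \<Rightarrow> real) \<Rightarrow> bool" where
  "lin_indep_mod_null E d g \<longleftrightarrow>
     (\<forall>a :: nat \<Rightarrow> real.
        (\<lambda>e. if e \<in> E then \<Sum>i<d. a i * g i e else 0) \<in> null_funs E \<longrightarrow> (\<forall>i<d. a i = 0))"

definition e_family ::
    "nat \<Rightarrow> (nat \<times> nat) set \<Rightarrow> (nat \<times> nat \<Rightarrow> real) set \<Rightarrow> nat \<Rightarrow> bool" where
  "e_family m E S d \<longleftrightarrow>
     S \<subseteq> kernels m E \<and>
     (\<exists>(\<Theta> :: (nat \<Rightarrow> real) set) (P :: (nat \<Rightarrow> real) \<Rightarrow> nat \<times> nat \<Rightarrow> real)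
        (K :: nat \<times> nat \<Rightarrow> real) (g :: nat \<Rightarrow> nat \<times> nat \<Rightarrow> real)
        (R :: (nat \<Rightarrow> real) \<Rightarrow> nat \<Rightarrow> real) (\<psi> :: (nat \<Rightarrow> real) \<Rightarrow> real).
        connectedin (Euclidean_space d) \<Theta> \<and>
        (\<exists>r>0. {\<theta> \<in> topspace (Euclidean_space d). L2_set \<theta> {..<d} < r} \<subseteq> \<Theta>) \<and>
        S = P ` \<Theta> \<and>
        lin_indep_mod_null E d g \<and>
        (\<forall>\<theta>\<in>\<Theta>.
           (\<forall>(x, x') \<in> E. ln (P \<theta> (x, x')) =
              K (x, x') + (\<Sum>i<d. \<theta> i * g i (x, x')) + R \<theta> x' - R \<theta> x - \<psi> \<theta>) \<and>
           (\<forall>e. e \<notin> E \<longrightarrow> P \<theta> e = 0)))"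

end

theory Submission
  imports Defs "Jordan_Normal_Form.Missing_VectorSpace"
begin

text \<open>
  On a connected symmetric graph, a function on the edges is log-reversible iff it is the sum of a
  symmetric function and a gradient \<open>f x' - f x\<close>: the antisymmetric part has zero sum along closed
  paths and is therefore integrable to a potential. A symmetric function is null only if it is
  constant, so the reversible generators are the symmetric functions modulo constants. A basis
  consists of the indicators of all unoriented edges but one, which are indexed by \<open>T_set m E\<close>.

  The same indicators parametrize the reversible kernels. The logarithm of a reversible kernel with
  stationary distribution \<open>\<pi>\<close> is a symmetric function plus the gradient of \<open>ln \<pi> / 2\<close>.
  Conversely, if \<open>v\<close> is the Perron eigenvector of the symmetric matrix \<open>exp S\<close> on \<open>E\<close> with
  eigenvalue \<open>l\<close>, then \<open>exp (S (x, x')) v x' / (l v x)\<close> is a kernel reversible with respect to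
  \<open>v\<^sup>2\<close>, and by the maximum principle it is the only kernel whose logarithm is \<open>S\<close> up to a null
  function. Hence the whole of \<open>\<real>\<^sup>d\<close> serves as parameter set.
\<close>

subsection \<open>Quotients of vector spaces\<close>

locale vectorspace_quotient = vectorspace K V for K :: "('a, 'k) ring_scheme" and V :: "('a, 'b, 'v) module_scheme" (structure) +
  fixes N :: "'b set"
  assumes subspace_N: "VectorSpace.subspace K N V"
begin

lemma abelian_subgroup_N: "abelian_subgroup N V"
proof (rule abelian_subgroupI3)
  interpret N: LinearCombinations.submodule K N V
    using subspace_N by (rule VectorSpace.subspace.submod)
  show "additive_subgroup N V"
  proof (rule additive_subgroup.intro, rule group.subgroupI[OF a_group])
    show "N \<noteq> {}" using N.zero_closed by blast
  next
    fix a assume a: "a \<in> N"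
    \<comment> \<open>Inverses come from scaling by minus one.\<close>
    have "(\<ominus>\<^bsub>K\<^esub> \<one>\<^bsub>K\<^esub>) \<odot> a \<in> N" by (rule N.smult_closed) (simp_all add: a)
    then show "inv\<^bsub>add_monoid V\<^esub> a \<in> N"
      using a N.subset by (metis a_inv_def smult_minus_1 subsetD)
  qed (use N.subset in auto)
  show "abelian_group V" ..
qed

sublocale N: abelian_subgroup N V by (rule abelian_subgroup_N)

lemma quotient_carrier: "carrier (quotient_space V N) = (\<lambda>h. N +> h) ` carrier V"
  by (auto simp: quotient_space_def A_RCOSETS_def')

lemma quotient_add:
  "g \<in> carrier V \<Longrightarrow> h \<in> carrier V \<Longrightarrow> (N +> g) \<oplus>\<^bsub>quotient_space V N\<^esub> (N +> h) = N +> (g \<oplus> h)"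
  by (simp add: quotient_space_def N.a_rcos_sum)

lemma quotient_smult:
  assumes c: "c \<in> carrier K" and h: "h \<in> carrier V"
  shows "c \<odot>\<^bsub>quotient_space V N\<^esub> (N +> h) = N +> (c \<odot> h)"
proof -
  interpret S: LinearCombinations.submodule K N V
    using subspace_N by (rule VectorSpace.subspace.submod)
  \<comment> \<open>Scalar multiplication of cosets is a union over all representatives. All its
    members coincide, and the index set is nonempty, so the union is a single coset.\<close>
  have "N +> (c \<odot> h') = N +> (c \<odot> h)" if h'N: "h' \<in> N +> h" for h'
  proof -
    obtain n where n: "n \<in> N" and h': "h' = n \<oplus> h"
      using h'N by (auto simp: a_r_coset_def')
    have nV: "n \<in> carrier V" using n S.subset by (rule rev_subsetD)
    have "c \<odot> h' = (c \<odot> n) \<oplus> (c \<odot> h)" unfolding h' by (rule smult_r_distr[OF c nV h])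
    moreover have "c \<odot> n \<in> N" by (rule S.smult_closed[OF c n])
    ultimately have "c \<odot> h' \<in> N +> (c \<odot> h)" by (auto simp: a_r_coset_def')
    then show ?thesis using N.a_repr_independence' smult_closed[OF c h] by metis
  qed
  then have "(\<Union>h'\<in>N +> h. N +> (c \<odot> h')) = (\<Union>h'\<in>N +> h. N +> (c \<odot> h))" by simp
  moreover have "N +> h \<noteq> {}" using N.a_rcos_self[OF h] by blast
  ultimately show ?thesis by (simp add: quotient_space_def)
qed

lemma quotient_zero: "\<zero>\<^bsub>quotient_space V N\<^esub> = N +> \<zero>"
  by (simp add: quotient_space_def N.a_rcos_const)

lemma quotient_coset_cong: "n \<in> N \<Longrightarrow> h \<in> carrier V \<Longrightarrow> N +> (n \<oplus> h) = N +> h"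
  by (rule N.a_repr_independence'[symmetric]) (auto simp: a_r_coset_def')

lemma vectorspace_quotient: "vectorspace K (quotient_space V N)"
proof -
  let ?Q = "quotient_space V N"
  have coset: "\<exists>h\<in>carrier V. A = N +> h" if "A \<in> carrier ?Q" for A
    using that unfolding quotient_carrier by blast
  have closed: "N +> h \<in> carrier ?Q" if "h \<in> carrier V" for h
    using that unfolding quotient_carrier by blast
  note ops = quotient_add quotient_smult quotient_zero closed
  show ?thesis
  proof (intro vectorspace.intro moduleI abelian_groupI)
    show "cring K" "field K" ..
    show "\<zero>\<^bsub>?Q\<^esub> \<in> carrier ?Q" unfolding quotient_zero by (rule closed) simp
    fix A assume "A \<in> carrier ?Q"
    then obtain f where f: "f \<in> carrier V" "A = N +> f" using coset by blast
    show "\<zero>\<^bsub>?Q\<^esub> \<oplus>\<^bsub>?Q\<^esub> A = A" unfolding f(2) quotient_zero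
      by (subst quotient_add) (simp_all add: f)
    show "\<exists>B\<in>carrier ?Q. B \<oplus>\<^bsub>?Q\<^esub> A = \<zero>\<^bsub>?Q\<^esub>"
      by (rule bexI[of _ "N +> \<ominus> f"]) (simp_all add: ops f l_neg)
    show "\<one>\<^bsub>K\<^esub> \<odot>\<^bsub>?Q\<^esub> A = A" by (simp add: ops f)
    fix a assume a: "a \<in> carrier K"
    show "a \<odot>\<^bsub>?Q\<^esub> A \<in> carrier ?Q" by (simp add: ops f a)
    fix b assume b: "b \<in> carrier K"
    show "(a \<oplus>\<^bsub>K\<^esub> b) \<odot>\<^bsub>?Q\<^esub> A = a \<odot>\<^bsub>?Q\<^esub> A \<oplus>\<^bsub>?Q\<^esub> b \<odot>\<^bsub>?Q\<^esub> A"
      by (simp add: ops f a b smult_l_distr)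
    show "(a \<otimes>\<^bsub>K\<^esub> b) \<odot>\<^bsub>?Q\<^esub> A = a \<odot>\<^bsub>?Q\<^esub> (b \<odot>\<^bsub>?Q\<^esub> A)"
      by (simp add: ops f a b smult_assoc1)
  next
    fix A B assume "A \<in> carrier ?Q" "B \<in> carrier ?Q"
    then obtain f g where f: "f \<in> carrier V" "A = N +> f" and g: "g \<in> carrier V" "B = N +> g"
      using coset by blast
    show "A \<oplus>\<^bsub>?Q\<^esub> B \<in> carrier ?Q" by (simp add: ops f g)
    show "A \<oplus>\<^bsub>?Q\<^esub> B = B \<oplus>\<^bsub>?Q\<^esub> A" by (simp add: ops f g a_comm)
    show "a \<odot>\<^bsub>?Q\<^esub> (A \<oplus>\<^bsub>?Q\<^esub> B) = a \<odot>\<^bsub>?Q\<^esub> A \<oplus>\<^bsub>?Q\<^esub> a \<odot>\<^bsub>?Q\<^esub> B" if "a \<in> carrier K" for a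
      by (simp add: ops f g that smult_r_distr)
    fix C assume "C \<in> carrier ?Q"
    then obtain h where h: "h \<in> carrier V" "C = N +> h" using coset by blast
    show "A \<oplus>\<^bsub>?Q\<^esub> B \<oplus>\<^bsub>?Q\<^esub> C = A \<oplus>\<^bsub>?Q\<^esub> (B \<oplus>\<^bsub>?Q\<^esub> C)" by (simp add: ops f g h a_assoc)
  qed
qed

end

lemma vectorspace_fun_space:
  assumes "(\<lambda>_. 0) \<in> H" and "\<And>g h. g \<in> H \<Longrightarrow> h \<in> H \<Longrightarrow> (\<lambda>e. g e + h e) \<in> H"
    and smult: "\<And>c h. h \<in> H \<Longrightarrow> (\<lambda>e. c * h e) \<in> H"
  shows "vectorspace class_ring (fun_space H)"
proof (intro vectorspace.intro moduleI abelian_groupI)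
  fix h assume "h \<in> carrier (fun_space H)"
  then have "(\<lambda>e. -1 * h e) \<in> carrier (fun_space H)"
    using smult[of h "-1"] by (simp add: fun_space_def)
  then show "\<exists>g\<in>carrier (fun_space H). g \<oplus>\<^bsub>fun_space H\<^esub> h = \<zero>\<^bsub>fun_space H\<^esub>"
    by (rule rev_bexI) (simp add: fun_space_def)
next
  show "field (class_ring :: real ring)" by (rule class_field)
  then show "cring (class_ring :: real ring)" by (simp add: field_def domain_def)
qed (use assms in \<open>auto simp: fun_space_def algebra_simps\<close>)

subsection \<open>Potentials of log-reversible functions\<close>

text \<open>Only the antisymmetric part enters log-reversibility, and the sum of a gradient along a
  closed path telescopes to zero.\<close>

lemma log_reversible_gradient:
  fixes f :: "nat \<Rightarrow> real"
  assumes "\<And>x y. (x, y) \<in> E \<Longrightarrow> h (x, y) - h (y, x) = f y - f x"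
  shows "log_reversible E h"
  unfolding log_reversible_def
proof (intro allI impI)
  fix n :: nat and p assume "n \<ge> 1" and p: "closed_path E n p"
  have "(\<Sum>t=1..n. h (p t, p (t + 1))) - (\<Sum>t=1..n. h (p (t + 1), p t))
      = (\<Sum>t=1..n. f (p (t + 1)) - f (p t))"
    using p assms by (auto simp: closed_path_def simp flip: sum_subtractf)
  also have "\<dots> = f (p (Suc n)) - f (p 1)"
    using sum_Suc_diff[of 1 n "\<lambda>t. f (p t)"] \<open>n \<ge> 1\<close> by simp
  also have "\<dots> = 0" using p by (simp add: closed_path_def)
  finally show "(\<Sum>t=1..n. h (p t, p (t + 1))) = (\<Sum>t=1..n. h (p (t + 1), p t))" by simp
qed

text \<open>Line integrals of the antisymmetric part of \<open>h\<close>. This is a relation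
  because, without log-reversibility, different walks between the same vertices may have different
  sums.\<close>

inductive walk_sum :: "(nat \<times> nat) set \<Rightarrow> (nat \<times> nat \<Rightarrow> real) \<Rightarrow> nat \<Rightarrow> nat \<Rightarrow> real \<Rightarrow> bool"
  for E h where
  walk_empty: "walk_sum E h x x 0"
| walk_step: "walk_sum E h x y s \<Longrightarrow> (y, z) \<in> E \<Longrightarrow> walk_sum E h x z (s + (h (y, z) - h (z, y)))"

lemma walk_sum_trans:
  "walk_sum E h y z t \<Longrightarrow> walk_sum E h x y s \<Longrightarrow> walk_sum E h x z (s + t)"
  by (induction rule: walk_sum.induct) (auto simp flip: add.assoc intro: walk_sum.intros)

text \<open>Each edge can be traversed backwards by symmetry of \<open>E\<close>, and its
  contribution changes sign.\<close>

lemma walk_sum_reverse: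
  assumes "sym E" shows "walk_sum E h x y s \<Longrightarrow> walk_sum E h y x (- s)"
proof (induction rule: walk_sum.induct)
  case (walk_step x y s z)
  have "walk_sum E h z y (0 + (h (z, y) - h (y, z)))"
    using walk_step assms by (intro walk_sum.intros) (auto dest: symD)
  from walk_sum_trans[OF walk_step.IH this] show ?case by simp
qed (auto intro: walk_empty[of E h, simplified])

lemma walk_sum_path:
  "walk_sum E h x y s \<Longrightarrow> \<exists>(n :: nat) p. p 1 = x \<and> p (n + 1) = y \<and> (\<forall>t\<in>{1..n}. (p t, p (t + 1)) \<in> E) \<and>
     s = (\<Sum>t=1..n. h (p t, p (t + 1)) - h (p (t + 1), p t))"
proof (induction rule: walk_sum.induct)
  case (walk_empty x)
  show ?case by (rule exI[of _ 0], rule exI[of _ "\<lambda>_. x"]) simp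
next
  case (walk_step x y s z)
  then obtain n :: nat and p where p: "p 1 = x" "p (n + 1) = y" "\<forall>t\<in>{1..n}. (p t, p (t + 1)) \<in> E"
    and s: "s = (\<Sum>t=1..n. h (p t, p (t + 1)) - h (p (t + 1), p t))" by blast
  \<comment> \<open>A path with \<open>n\<close> edges occupies the indices 1 to
    \<open>n + 1\<close>, so the new end vertex gets index \<open>n + 2\<close>.\<close>
  let ?q = "p(n + 2 := z)"
  have "(\<Sum>t=1..n. h (?q t, ?q (t + 1)) - h (?q (t + 1), ?q t)) = s"
    unfolding s by (rule sum.cong) auto
  then show ?case using p walk_step.hyps(2)
    by (intro exI[of _ "Suc n"] exI[of _ ?q]) (auto simp: le_Suc_eq)
qed

lemma walk_sum_closed:
  assumes "log_reversible E h" and "walk_sum E h x x s"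
  shows "s = 0"
proof -
  obtain n :: nat and p where p: "p 1 = x" "p (n + 1) = x" "\<forall>t\<in>{1..n}. (p t, p (t + 1)) \<in> E"
    and s: "s = (\<Sum>t=1..n. h (p t, p (t + 1)) - h (p (t + 1), p t))"
    using walk_sum_path[OF assms(2)] by blast
  show ?thesis
  \<comment> \<open>Log-reversibility speaks of paths with at least one edge; the empty walk has sum
    zero anyway.\<close>
  proof (cases "n = 0")
    case False
    then show ?thesis using assms(1) p s by (simp add: log_reversible_def closed_path_def sum_subtractf)
  qed (simp add: s)
qed

section \<open>Connectedness and potentials\<close>

locale reversible_graph =
  fixes m :: nat and E :: "(nat \<times> nat) set"
  assumes m_ge_2: "m \<ge> 2"
    and strongly_connected: "strongly_connected_digraph m E"
    and sym_E: "sym E"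
begin

lemma edge_vertices: "(x, y) \<in> E \<Longrightarrow> x \<in> {1..m} \<and> y \<in> {1..m}"
  using strongly_connected by (auto simp: strongly_connected_digraph_def)

lemma edge_sym: "(x, y) \<in> E \<Longrightarrow> (y, x) \<in> E"
  using sym_E by (rule symD)

lemma finite_E: "finite E"
  using strongly_connected finite_subset[of E "{1..m} \<times> {1..m}"]
  by (auto simp: strongly_connected_digraph_def)

text \<open>Strong connectivity as an induction principle: what holds at one vertex and spreads
  along edges holds everywhere.\<close>

lemma closed_vertex_set:
  assumes "x \<in> A" "x \<in> {1..m}" "\<And>y z. y \<in> A \<Longrightarrow> (y, z) \<in> E \<Longrightarrow> z \<in> A" "y \<in> {1..m}"
  shows "y \<in> A"
proof -
  have "(x, y) \<in> E\<^sup>*" using strongly_connected assms by (auto simp: strongly_connected_digraph_def)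
  then show ?thesis by induction (use assms in auto)
qed

text \<open>Otherwise \<open>{x}\<close> would be closed under edges and would contain both 1 and
  2.\<close>

lemma neighbour: assumes "x \<in> {1..m}" shows "\<exists>y. (x, y) \<in> E"
proof (rule ccontr)
  assume "\<nexists>y. (x, y) \<in> E"
  then have "y \<in> {x}" if "y \<in> {1..m}" for y
    using closed_vertex_set[of x "{x}" y] assms that by blast
  from this[of 1] this[of 2] m_ge_2 show False by simp
qed

text \<open>The potential at \<open>y\<close> is the sum along an arbitrarily chosen walk from
  vertex 1; vanishing sums of closed walks make the choice immaterial.\<close>

lemma log_reversible_potential:
  assumes "log_reversible E h"
  obtains f where "\<And>x y. (x, y) \<in> E \<Longrightarrow> h (x, y) - h (y, x) = f y - f x"
proof -
  have ex: "\<exists>s. walk_sum E h 1 y s" if "y \<in> {1..m}" for y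
    using closed_vertex_set[of 1 "{y. \<exists>s. walk_sum E h 1 y s}" y] that m_ge_2
    by (auto intro: walk_sum.intros)
  define f where "f y = (SOME s. walk_sum E h 1 y s)" for y
  have f: "walk_sum E h 1 y (f y)" if "y \<in> {1..m}" for y
    unfolding f_def using ex[OF that] by (rule someI_ex)
  have "h (x, y) - h (y, x) = f y - f x" if xy: "(x, y) \<in> E" for x y
  proof -
    have "walk_sum E h 1 y (f x + (h (x, y) - h (y, x)))"
      using f edge_vertices xy by (auto intro: walk_step)
    \<comment> \<open>Going to \<open>x\<close>, over the edge to \<open>y\<close>, and back along
      the chosen walk of \<open>y\<close> closes the walk at 1.\<close>
    from walk_sum_trans[OF walk_sum_reverse[OF sym_E f] this] edge_vertices[OF xy]
    have "walk_sum E h 1 1 (f x + (h (x, y) - h (y, x)) + - f y)" by blast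
    from walk_sum_closed[OF assms this] show ?thesis by simp
  qed
  then show ?thesis by (rule that)
qed

end

subsection \<open>Symmetric functions on the edges\<close>

lemma null_funsI:
  assumes "h \<in> edge_funs E" "\<And>x y. (x, y) \<in> E \<Longrightarrow> h (x, y) = f y - f x + c"
  shows "h \<in> null_funs E"
  using assms unfolding null_funs_def by blast

lemma null_funsE:
  assumes "h \<in> null_funs E"
  obtains c f where "h \<in> edge_funs E" "\<And>x y. (x, y) \<in> E \<Longrightarrow> h (x, y) = f y - f x + c"
  using assms unfolding null_funs_def by blast

lemma null_funs_zero: "(\<lambda>_. 0) \<in> null_funs E"
  by (rule null_funsI[of _ _ "\<lambda>_. 0" 0]) (simp_all add: edge_funs_def)

lemma null_funs_add:
  assumes "h \<in> null_funs E" "h' \<in> null_funs E" shows "(\<lambda>e. h e + h' e) \<in> null_funs E"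
proof -
  obtain c f where h: "h \<in> edge_funs E" "\<And>x y. (x, y) \<in> E \<Longrightarrow> h (x, y) = f y - f x + c"
    using assms(1) by (rule null_funsE) blast
  obtain c' f' where h': "h' \<in> edge_funs E" "\<And>x y. (x, y) \<in> E \<Longrightarrow> h' (x, y) = f' y - f' x + c'"
    using assms(2) by (rule null_funsE) blast
  show ?thesis
    by (rule null_funsI[of _ _ "\<lambda>x. f x + f' x" "c + c'"])
      (use h h' in \<open>simp_all add: edge_funs_def\<close>)
qed

lemma null_funs_smult:
  assumes "h \<in> null_funs E" shows "(\<lambda>e. b * h e) \<in> null_funs E"
proof -
  obtain c f where h: "h \<in> edge_funs E" "\<And>x y. (x, y) \<in> E \<Longrightarrow> h (x, y) = f y - f x + c"
    using assms by (rule null_funsE) blast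
  show ?thesis
    by (rule null_funsI[of _ _ "\<lambda>x. b * f x" "b * c"])
      (use h in \<open>simp_all add: edge_funs_def right_diff_distrib distrib_left\<close>)
qed

lemma rev_funs_zero: "(\<lambda>_. 0) \<in> rev_funs E"
  by (simp add: rev_funs_def edge_funs_def log_reversible_def)

lemma rev_funs_add: "h \<in> rev_funs E \<Longrightarrow> h' \<in> rev_funs E \<Longrightarrow> (\<lambda>e. h e + h' e) \<in> rev_funs E"
  by (simp add: rev_funs_def edge_funs_def log_reversible_def sum.distrib)

lemma rev_funs_smult: "h \<in> rev_funs E \<Longrightarrow> (\<lambda>e. c * h e) \<in> rev_funs E"
  by (simp add: rev_funs_def edge_funs_def log_reversible_def flip: sum_distrib_left)

context reversible_graph
begin

lemma x_star: "(m, x_star m E) \<in> E" "x_star m E \<le> m"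
proof -
  let ?A = "{x \<in> {1..m}. (m, x) \<in> E}"
  have "?A \<noteq> {}" using neighbour[of m] m_ge_2 edge_vertices by fastforce
  then have "x_star m E \<in> ?A" unfolding x_star_def by (intro Min_in) auto
  then show "(m, x_star m E) \<in> E" "x_star m E \<le> m" by auto
qed

section \<open>Indicators of unoriented edges\<close>

lemma finite_T: "finite (T_set m E)"
  by (rule finite_subset[OF _ finite_E]) (auto simp: T_set_def)

definition d :: nat where "d = card (T_set m E)"

definition T_enum :: "nat \<Rightarrow> nat \<times> nat" where
  "T_enum = (SOME e. bij_betw e {0..<d} (T_set m E))"

lemma T_enum: "bij_betw T_enum {0..<d} (T_set m E)"
  unfolding T_enum_def d_def using ex_bij_betw_nat_finite[OF finite_T] by (rule someI_ex)

text \<open>The representative of an unoriented edge with the larger vertex first, which is the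
  convention of \<open>T_set\<close>.\<close>

definition orient :: "nat \<times> nat \<Rightarrow> nat \<times> nat" where
  "orient = (\<lambda>(x, y). (max x y, min x y))"

definition g :: "nat \<Rightarrow> nat \<times> nat \<Rightarrow> real" where
  "g i e = of_bool (orient e = T_enum i)"

lemma orient_commute: "orient (x, y) = orient (y, x)"
  by (simp add: orient_def max.commute min.commute)

lemma orient_in_E_iff: "orient e \<in> E \<longleftrightarrow> e \<in> E"
  by (cases e) (auto simp: orient_def max_def min_def intro: edge_sym)

lemma T_enum_eq_iff: "i < d \<Longrightarrow> j < d \<Longrightarrow> T_enum i = T_enum j \<longleftrightarrow> i = j"
  using T_enum by (meson atLeastLessThan_iff bij_betw_def inj_onD zero_le)

lemma orient_cases:
  assumes "e \<in> E"
  obtains "orient e = (m, x_star m E)" | i where "i < d" "orient e = T_enum i"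
proof (cases "orient e = (m, x_star m E)")
  case False
  have "orient e \<in> E" using assms by (simp add: orient_in_E_iff)
  with False have "orient e \<in> T_set m E" by (cases e) (auto simp: T_set_def orient_def)
  then have "orient e \<in> T_enum ` {0..<d}" using T_enum by (simp add: bij_betw_def)
  then show ?thesis using that(2) by auto
qed (rule that(1))

lemma T_enum_in_T: "i < d \<Longrightarrow> T_enum i \<in> T_set m E"
  using T_enum by (auto simp: bij_betw_def)

lemma T_enum_in_E: "i < d \<Longrightarrow> T_enum i \<in> E"
  using T_enum_in_T[of i] by (auto simp: T_set_def)

lemma orient_T_enum: "i < d \<Longrightarrow> orient (T_enum i) = T_enum i"
  using T_enum_in_T[of i] by (auto simp: T_set_def orient_def)

lemma orient_x_star: "orient (m, x_star m E) = (m, x_star m E)"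
  using x_star by (simp add: orient_def)

text \<open>Only the values \<open>a j\<close> with \<open>j < d\<close> count, so vectors and
  sequences can both supply the coefficients.\<close>

definition comb :: "(nat \<Rightarrow> real) \<Rightarrow> nat \<times> nat \<Rightarrow> real" where
  "comb a e = (\<Sum>j<d. a j * g j e)"

lemma comb_T_enum: assumes "i < d" "orient e = T_enum i" shows "comb a e = a i"
proof -
  have "g j e = (if j = i then 1 else 0)" if "j < d" for j
    using T_enum_eq_iff[OF assms(1) that] unfolding g_def assms(2) by simp
  then have "comb a e = (\<Sum>j<d. if j = i then a i else 0)"
    unfolding comb_def by (intro sum.cong) auto
  then show ?thesis using assms(1) by simp
qed

lemma comb_x_star: "orient e = (m, x_star m E) \<Longrightarrow> comb a e = 0"
unfolding comb_def
proof (intro sum.neutral ballI)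
  fix j assume "orient e = (m, x_star m E)" "j \<in> {..<d}"
  then show "a j * g j e = 0" using T_enum_in_T[of j] by (auto simp: g_def T_set_def)
qed

lemma comb_off_E: "e \<notin> E \<Longrightarrow> comb a e = 0"
unfolding comb_def
proof (intro sum.neutral ballI)
  fix j assume "e \<notin> E" "j \<in> {..<d}"
  then show "a j * g j e = 0" using T_enum_in_E[of j] orient_in_E_iff[of e] by (auto simp: g_def)
qed

lemma comb_commute: "comb a (x, y) = comb a (y, x)"
  by (simp add: comb_def g_def orient_commute)

text \<open>Subtracting the constant makes \<open>S\<close> vanish on the one unoriented edge that
  has no indicator; the coefficients are then the values on the other edges.\<close>

lemma symmetric_expansion:
  assumes S: "\<And>x y. (x, y) \<in> E \<Longrightarrow> S (x, y) = S (y, x)" and "e \<in> E"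
  shows "comb (\<lambda>j. S (T_enum j) - S (m, x_star m E)) e = S e - S (m, x_star m E)"
proof -
  have S_orient: "S (orient e) = S e"
    using S[of "fst e" "snd e"] assms(2)
    by (cases "fst e \<le> snd e") (auto simp: orient_def split_beta max_def min_def)
  show ?thesis
    by (rule orient_cases[OF assms(2)]) (simp_all add: comb_T_enum comb_x_star flip: S_orient)
qed

text \<open>Comparing an edge with its reverse cancels the potential, so a symmetric null function
  is a constant. The omitted edge, where \<open>comb a\<close> is 0, forces this constant to be
  0.\<close>

lemma null_coefficients:
  assumes "comb a \<in> null_funs E" "i < d"
  shows "a i = 0"
proof -
  obtain c f where cf: "\<And>x y. (x, y) \<in> E \<Longrightarrow> comb a (x, y) = f y - f x + c"
    using assms(1) by (rule null_funsE) blast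
  have c: "comb a (x, y) = c" if "(x, y) \<in> E" for x y
    using cf[OF that] cf[OF edge_sym[OF that]] comb_commute[of a x y] by simp
  have "c = 0" using c[OF x_star(1)] comb_x_star[OF orient_x_star] by simp
  moreover have "comb a (T_enum i) = a i" using assms(2) by (intro comb_T_enum orient_T_enum)
  moreover have "comb a (T_enum i) = c" using T_enum_in_E[OF assms(2)] c by (metis surj_pair)
  ultimately show ?thesis by simp
qed

lemma lin_indep_g: "lin_indep_mod_null E d g"
  unfolding lin_indep_mod_null_def
proof (intro allI impI)
  fix a i assume a: "(\<lambda>e. if e \<in> E then \<Sum>i<d. a i * g i e else 0) \<in> null_funs E" "i < d"
  have "(\<lambda>e. if e \<in> E then \<Sum>i<d. a i * g i e else 0) = comb a"
    using comb_off_E[of _ a] by (intro ext) (simp add: comb_def)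
  with a show "a i = 0" using null_coefficients[of a i] by simp
qed

section \<open>Null functions and symmetric functions are log-reversible\<close>

lemma rev_funsI:
  assumes "h \<in> edge_funs E" "\<And>x y. (x, y) \<in> E \<Longrightarrow> h (x, y) - h (y, x) = f y - f x"
  shows "h \<in> rev_funs E"
  using assms log_reversible_gradient[of E h f] by (simp add: rev_funs_def)

lemma null_funs_subset_rev_funs: "null_funs E \<subseteq> rev_funs E"
proof
  fix h assume "h \<in> null_funs E"
  then obtain c f where h: "h \<in> edge_funs E" "\<And>x y. (x, y) \<in> E \<Longrightarrow> h (x, y) = f y - f x + c"
    by (rule null_funsE) blast
  \<comment> \<open>The constant cancels in the antisymmetric difference and the gradient
    doubles.\<close>
  show "h \<in> rev_funs E"
    by (rule rev_funsI[of _ "\<lambda>x. 2 * f x"]) (use h edge_sym in simp_all)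
qed

lemma comb_in_rev_funs: "comb a \<in> rev_funs E"
proof (rule rev_funsI[of _ "\<lambda>_. 0"])
  show "comb a (x, y) - comb a (y, x) = 0 - 0" for x y
    using comb_commute[of a x y] by simp
qed (simp add: edge_funs_def comb_off_E)

end

subsection \<open>The space of reversible generators\<close>

context reversible_graph
begin

lemma vectorspace_rev_funs: "vectorspace class_ring (fun_space (rev_funs E))"
  by (intro vectorspace_fun_space rev_funs_zero rev_funs_add rev_funs_smult)

lemma subspace_null_funs: "VectorSpace.subspace class_ring (null_funs E) (fun_space (rev_funs E))"
  using vectorspace_rev_funs null_funs_subset_rev_funs
  by (auto simp: VectorSpace.subspace_def LinearCombinations.submodule_def vectorspace_def fun_space_def
      null_funs_zero null_funs_add null_funs_smult)

sublocale G: vectorspace_quotient class_ring "fun_space (rev_funs E)" "null_funs E"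
  by (intro vectorspace_quotient.intro vectorspace_quotient_axioms.intro
      vectorspace_rev_funs subspace_null_funs)

abbreviation coset :: "(nat \<times> nat \<Rightarrow> real) \<Rightarrow> (nat \<times> nat \<Rightarrow> real) set" where
  "coset h \<equiv> null_funs E +>\<^bsub>fun_space (rev_funs E)\<^esub> h"

lemma comb_carrier: "comb a \<in> carrier (fun_space (rev_funs E))"
  using comb_in_rev_funs by (simp add: fun_space_def)

text \<open>Half the antisymmetric difference is the gradient of \<open>f / 2\<close>, hence null.
  What remains is the symmetric mean, which is \<open>comb a\<close> up to a constant.\<close>

lemma symmetric_part_coset:
  assumes "h \<in> rev_funs E"
  obtains a where "coset h = coset (comb a)"
proof -
  have h: "h \<in> edge_funs E" and rev: "log_reversible E h"
    using assms by (simp_all add: rev_funs_def)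
  obtain f where f: "\<And>x y. (x, y) \<in> E \<Longrightarrow> h (x, y) - h (y, x) = f y - f x"
    using log_reversible_potential[OF rev] by blast
  define S where "S = (\<lambda>(x, y). (h (x, y) + h (y, x)) / 2)"
  define a where "a = (\<lambda>j. S (T_enum j) - S (m, x_star m E))"
  define n where "n e = h e - comb a e" for e
  have "n (x, y) = f y / 2 - f x / 2 + S (m, x_star m E)" if "(x, y) \<in> E" for x y
  proof -
    have "comb a (x, y) = S (x, y) - S (m, x_star m E)"
      unfolding a_def by (rule symmetric_expansion[OF _ that]) (simp add: S_def add.commute)
    then show ?thesis using f[OF that] by (simp add: n_def S_def field_simps)
  qed
  moreover have "n \<in> edge_funs E" using h by (simp add: edge_funs_def n_def comb_off_E)
  ultimately have n: "n \<in> null_funs E"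
    by (intro null_funsI[of n E "\<lambda>x. f x / 2" "S (m, x_star m E)"])
  have "h = n \<oplus>\<^bsub>fun_space (rev_funs E)\<^esub> comb a" by (simp add: fun_space_def n_def)
  then have "coset h = coset (comb a)" using G.quotient_coset_cong[OF n comb_carrier, of a] by simp
  then show ?thesis by (rule that)
qed

text \<open>The coordinate map from \<real>^d, which will turn out to be an isomorphism and so
  transfer the dimension.\<close>

lemma G_rev_linear_map:
  "linear_map class_ring (module_vec TYPE(real) d) (G_rev E) (\<lambda>v. coset (comb (($) v)))"
proof -
  let ?V = "fun_space (rev_funs E)"
  let ?T = "\<lambda>v. coset (comb (($) v))"
  have vs: "vectorspace class_ring (module_vec TYPE(real) d)" by (rule vec_vs)
  have vs': "vectorspace class_ring (G_rev E)" unfolding G_rev_def by (rule G.vectorspace_quotient)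
  have add: "?T (v + w) = ?T v \<oplus>\<^bsub>G_rev E\<^esub> ?T w" if "v \<in> carrier_vec d" "w \<in> carrier_vec d" for v w
  proof -
    have "comb (($) (v + w)) e = comb (($) v) e + comb (($) w) e" for e
      unfolding comb_def sum.distrib[symmetric] using that by (intro sum.cong) (auto simp: distrib_right)
    then have "comb (($) (v + w)) = comb (($) v) \<oplus>\<^bsub>?V\<^esub> comb (($) w)"
      by (intro ext) (simp add: fun_space_def)
    then show ?thesis
      unfolding G_rev_def by (simp only: G.quotient_add[OF comb_carrier comb_carrier])
  qed
  have smult: "?T (c \<cdot>\<^sub>v v) = c \<odot>\<^bsub>G_rev E\<^esub> ?T v" if "v \<in> carrier_vec d" for c v
  proof -
    have "comb (($) (c \<cdot>\<^sub>v v)) e = c * comb (($) v) e" for e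
      unfolding comb_def sum_distrib_left using that by (intro sum.cong) auto
    then have "comb (($) (c \<cdot>\<^sub>v v)) = c \<odot>\<^bsub>?V\<^esub> comb (($) v)"
      by (intro ext) (simp add: fun_space_def)
    moreover have "c \<in> carrier class_ring" by simp
    ultimately show ?thesis
      unfolding G_rev_def by (simp only: G.quotient_smult[OF _ comb_carrier])
  qed
  have closed: "?T v \<in> carrier (G_rev E)" for v
    unfolding G_rev_def G.quotient_carrier using comb_carrier by (rule imageI)
  have "?T \<in> module_hom class_ring (module_vec TYPE(real) d) (G_rev E)"
    unfolding module_hom_def mem_Collect_eq module_vec_simps
    by (intro conjI allI impI Pi_I closed add smult) blast+
  then show ?thesis
    by (intro linear_map.intro mod_hom.intro mod_hom_axioms.intro vs vs' vectorspace.axioms(1))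
qed

lemma G_rev_dim:
  "vectorspace class_ring (G_rev E)" "vectorspace.fin_dim class_ring (G_rev E)"
  "vectorspace.dim class_ring (G_rev E) = d"
proof -
  let ?T = "\<lambda>v. coset (comb (($) v))"
  interpret vec: vec_space "TYPE(real)" d .
  interpret T: linear_map class_ring "module_vec TYPE(real) d" "G_rev E" ?T
    by (rule G_rev_linear_map)
  have carrier: "carrier (module_vec TYPE(real) d) = carrier_vec d" by (simp add: module_vec_def)
  have zero: "\<zero>\<^bsub>G_rev E\<^esub> = null_funs E" by (simp add: G_rev_def quotient_space_def)
  have surj: "?T ` carrier (module_vec TYPE(real) d) = carrier (G_rev E)"
  proof (intro equalityI subsetI)
    fix A assume "A \<in> carrier (G_rev E)"
    then obtain h where h: "h \<in> rev_funs E" "A = coset h"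
      unfolding G_rev_def G.quotient_carrier by (auto simp: fun_space_def)
    obtain a where a: "coset h = coset (comb a)" using h(1) by (rule symmetric_part_coset)
    \<comment> \<open>Truncating \<open>a\<close> to a vector loses nothing, as \<open>comb\<close>
      reads only the first \<open>d\<close> coefficients.\<close>
    have "comb (($) (Matrix.vec d a)) = comb a" by (simp add: comb_def fun_eq_iff)
    then have "A = ?T (Matrix.vec d a)" using h(2) a by simp
    moreover have "Matrix.vec d a \<in> carrier (module_vec TYPE(real) d)" by (simp add: carrier)
    ultimately show "A \<in> ?T ` carrier (module_vec TYPE(real) d)" by (rule image_eqI)
  next
    fix A assume "A \<in> ?T ` carrier (module_vec TYPE(real) d)"
    then show "A \<in> carrier (G_rev E)" using T.T_im by blast
  qed
  have "T.ker = {\<zero>\<^bsub>module_vec TYPE(real) d\<^esub>}"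
  proof (intro equalityI subsetI)
    fix v assume "v \<in> T.ker"
    then have v: "v \<in> carrier_vec d" and Tv: "?T v = null_funs E"
      unfolding T.ker_def carrier zero by simp_all
    \<comment> \<open>The zero of the quotient is \<open>null_funs E\<close> itself, so a coset
      equal to it has a null representative.\<close>
    have "comb (($) v) \<in> ?T v" by (rule G.N.a_rcos_self[OF comb_carrier])
    then have "v $ i = 0" if "i < d" for i
      using null_coefficients[of "($) v" i] that unfolding Tv by simp
    then have "v = 0\<^sub>v d" using v by (intro eq_vecI) simp_all
    then show "v \<in> {\<zero>\<^bsub>module_vec TYPE(real) d\<^esub>}" by (simp add: module_vec_def)
  next
    fix v assume "v \<in> {\<zero>\<^bsub>module_vec TYPE(real) d\<^esub>}"
    then have "v = \<zero>\<^bsub>module_vec TYPE(real) d\<^esub>" by (rule singletonD)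
    then show "v \<in> T.ker" unfolding T.ker_def using T.f0_is_0 by (simp add: module_vec_def)
  qed
  then have inj: "inj_on ?T (carrier (module_vec TYPE(real) d))"
    by (intro T.Ke0_imp_inj) simp
  show "vectorspace class_ring (G_rev E)" unfolding G_rev_def by (rule G.vectorspace_quotient)
  have fin: "vectorspace.fin_dim class_ring (module_vec TYPE(real) d)" using vec.fin_dim by simp
  show "vectorspace.fin_dim class_ring (G_rev E)" by (rule T.surj_fin_dim[OF fin surj])
  show "vectorspace.dim class_ring (G_rev E) = d"
    using T.dim_eq[OF fin inj surj] vec.dim_is_n by simp
qed

end

subsection \<open>Perron vectors of symmetric matrices\<close>

lemma continuous_on_coordinate_sums:
  fixes I :: "nat set" and W :: "nat \<Rightarrow> nat \<Rightarrow> real"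
  shows "continuous_on UNIV (\<lambda>x :: nat \<Rightarrow> real. \<Sum>i\<in>I. (x i)\<^sup>2)"
    and "continuous_on UNIV (\<lambda>x :: nat \<Rightarrow> real. \<Sum>i\<in>I. \<Sum>j\<in>I. x i * W i j * x j)"
  by (intro continuous_intros continuous_on_product_coordinates)+

text \<open>Vectors are extended by 0 outside \<open>I\<close>, so the set is the part of a closed
  sphere in a product of compact intervals and singletons, which is compact by Tychonoff.\<close>

lemma compact_nonneg_sphere:
  assumes "finite I"
  shows "compact {x :: nat \<Rightarrow> real. (\<forall>i\<in>I. 0 \<le> x i) \<and> (\<forall>i. i \<notin> I \<longrightarrow> x i = 0) \<and> (\<Sum>i\<in>I. (x i)\<^sup>2) = 1}"
    (is "compact ?K")
proof -
  let ?B = "PiE UNIV (\<lambda>i. if i \<in> I then {0..1} else {0 :: real})"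
  have "compactin (product_topology (\<lambda>_. euclidean) UNIV) ?B"
    by (simp add: compactin_PiE)
  then have B: "compact ?B" by (simp add: euclidean_product_topology)
  have "closed {x :: nat \<Rightarrow> real. (\<Sum>i\<in>I. (x i)\<^sup>2) = 1}"
    by (intro closed_Collect_eq continuous_on_coordinate_sums continuous_on_const)
  with B have "compact (?B \<inter> {x. (\<Sum>i\<in>I. (x i)\<^sup>2) = 1})" by (rule compact_Int_closed)
  also have "?B \<inter> {x. (\<Sum>i\<in>I. (x i)\<^sup>2) = 1} = ?K"
  proof (intro equalityI subsetI)
    fix x assume "x \<in> ?K"
    then have x: "\<forall>i\<in>I. 0 \<le> x i" "\<forall>i. i \<notin> I \<longrightarrow> x i = 0" "(\<Sum>i\<in>I. (x i)\<^sup>2) = 1" by auto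
    have "x i \<le> 1" if "i \<in> I" for i
    proof -
      have "(x i)\<^sup>2 \<le> (\<Sum>i\<in>I. (x i)\<^sup>2)" by (rule member_le_sum) (use assms that in auto)
      then have "(x i)\<^sup>2 \<le> 1\<^sup>2" using x(3) by simp
      then show ?thesis by (rule power2_le_imp_le) simp
    qed
    with x show "x \<in> ?B \<inter> {x. (\<Sum>i\<in>I. (x i)\<^sup>2) = 1}" by (auto simp: PiE_iff)
  qed (force simp: PiE_iff split: if_splits)
  finally show ?thesis .
qed

text \<open>
  Only one-sided variations \<open>v + t e\<^sub>x\<close> with \<open>t > 0\<close> stay in the cone of nonnegative vectors,
  whence an inequality instead of an eigenvalue equation.
\<close>

lemma quadratic_form_maximizer:
  fixes W :: "nat \<Rightarrow> nat \<Rightarrow> real"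
  assumes I: "finite I" "I \<noteq> {}" and W: "\<And>x y. W x y = W y x"
  obtains v l where "\<And>x. x \<in> I \<Longrightarrow> v x \<ge> 0" "(\<Sum>x\<in>I. (v x)\<^sup>2) = 1"
    "(\<Sum>x\<in>I. v x * (\<Sum>y\<in>I. W x y * v y)) = l"
    "\<And>x. x \<in> I \<Longrightarrow> (\<Sum>y\<in>I. W x y * v y) \<le> l * v x"
proof -
  define K where
    "K = {x :: nat \<Rightarrow> real. (\<forall>i\<in>I. 0 \<le> x i) \<and> (\<forall>i. i \<notin> I \<longrightarrow> x i = 0) \<and> (\<Sum>i\<in>I. (x i)\<^sup>2) = 1}"
  define Q where "Q v = (\<Sum>x\<in>I. \<Sum>y\<in>I. v x * W x y * v y)" for v
  obtain i where i: "i \<in> I" using I(2) by blast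
  have "(\<Sum>j\<in>I. (if j = i then 1 else 0 :: real)\<^sup>2) = (\<Sum>j\<in>I. if j = i then 1 else 0)"
    by (intro sum.cong) auto
  then have "(\<lambda>x. if x = i then 1 else 0) \<in> K"
    using I(1) i by (simp add: K_def)
  then have "K \<noteq> {}" by (metis empty_iff)
  moreover have "compact K" unfolding K_def by (rule compact_nonneg_sphere[OF I(1)])
  moreover have "continuous_on K Q" unfolding Q_def
    by (rule continuous_on_subset[OF continuous_on_coordinate_sums(2)]) (rule subset_UNIV)
  ultimately have "\<exists>v\<in>K. \<forall>u\<in>K. Q u \<le> Q v" by (intro continuous_attains_sup)
  then obtain v where vK: "v \<in> K" and max: "\<And>u. u \<in> K \<Longrightarrow> Q u \<le> Q v" by blast
  have v: "\<And>x. x \<in> I \<Longrightarrow> 0 \<le> v x" "(\<Sum>x\<in>I. (v x)\<^sup>2) = 1" using vK by (simp_all add: K_def)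
  \<comment> \<open>The Rayleigh quotient bound, carried by scaling from the sphere to the whole
    cone.\<close>
  have homogeneous: "Q u \<le> Q v * (\<Sum>x\<in>I. (u x)\<^sup>2)" if u: "\<And>x. x \<in> I \<Longrightarrow> u x \<ge> 0" for u
  proof (cases "(\<Sum>x\<in>I. (u x)\<^sup>2) = 0")
    case True
    then have "\<forall>x\<in>I. u x = 0" using I by (simp add: sum_nonneg_eq_0_iff)
    then show ?thesis using True by (simp add: Q_def)
  next
    case False
    define r where "r = sqrt (\<Sum>x\<in>I. (u x)\<^sup>2)"
    have r2: "r\<^sup>2 = (\<Sum>x\<in>I. (u x)\<^sup>2)" unfolding r_def by (intro real_sqrt_pow2 sum_nonneg) auto
    have r: "r > 0" using False sum_nonneg[of I "\<lambda>x. (u x)\<^sup>2"] by (simp add: r_def)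
    define w where "w x = (if x \<in> I then u x / r else 0)" for x
    have "(\<Sum>x\<in>I. (w x)\<^sup>2) = (\<Sum>x\<in>I. (u x)\<^sup>2) / r\<^sup>2"
      by (simp add: w_def power_divide sum_divide_distrib)
    then have "w \<in> K" using u r by (simp add: K_def w_def flip: r2)
    moreover have "Q w = Q u / r\<^sup>2"
      by (simp add: Q_def w_def sum_divide_distrib power2_eq_square mult.assoc)
    ultimately have "Q u / r\<^sup>2 \<le> Q v" using max by metis
    then show ?thesis using r by (simp add: divide_le_eq flip: r2)
  qed
  have Q_alt: "Q v = (\<Sum>x\<in>I. v x * (\<Sum>y\<in>I. W x y * v y))" for v
    by (simp add: Q_def sum_distrib_left mult.assoc)
  have le: "(\<Sum>y\<in>I. W x y * v y) \<le> Q v * v x" if x: "x \<in> I" for x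
  proof -
    define s where "s = (\<Sum>y\<in>I. W x y * v y)"
    \<comment> \<open>This is \<open>homogeneous\<close> expanded at \<open>v\<close> plus
      \<open>t\<close> times the unit vector at \<open>x\<close>; the terms without \<open>t\<close>
      cancel because \<open>v\<close> has norm 1.\<close>
    have quad: "2 * t * s + t\<^sup>2 * W x x \<le> Q v * (2 * t * v x + t\<^sup>2)" if "t > 0" for t
    proof -
      define u where "u y = v y + (if y = x then t else 0)" for y
      have delta: "(\<Sum>y\<in>I. f y * (if y = x then t else 0)) = f x * t" for f :: "nat \<Rightarrow> real"
      proof -
        have "(\<Sum>y\<in>I. f y * (if y = x then t else 0)) = (\<Sum>y\<in>I. if y = x then f x * t else 0)"
          by (intro sum.cong) auto
        then show ?thesis using I x by simp
      qed
      have W_u: "(\<Sum>z\<in>I. W y z * u z) = (\<Sum>z\<in>I. W y z * v z) + W y x * t" for y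
        unfolding u_def distrib_left sum.distrib delta ..
      have "(\<Sum>y\<in>I. v y * (W y x * t)) = t * s"
        unfolding s_def sum_distrib_left by (intro sum.cong) (auto simp: W[of x])
      moreover have "Q u = (\<Sum>y\<in>I. v y * (\<Sum>z\<in>I. W y z * v z)) + (\<Sum>y\<in>I. v y * (W y x * t))
          + (\<Sum>y\<in>I. ((\<Sum>z\<in>I. W y z * v z) + W y x * t) * (if y = x then t else 0))"
        unfolding Q_alt W_u sum.distrib[symmetric]
        by (intro sum.cong) (simp_all add: u_def algebra_simps)
      ultimately have "Q u = Q v + t * s + t * (s + W x x * t)"
        unfolding delta by (simp add: Q_alt s_def mult.commute)
      moreover have "(\<Sum>y\<in>I. (u y)\<^sup>2) = 1 + 2 * t * v x + t\<^sup>2"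
      proof -
        have "(\<Sum>y\<in>I. (u y)\<^sup>2) = (\<Sum>y\<in>I. (v y)\<^sup>2 + (if y = x then 2 * t * v x + t\<^sup>2 else 0))"
          by (intro sum.cong) (auto simp: u_def power2_sum)
        then show ?thesis using I x v by (simp add: sum.distrib)
      qed
      moreover have "Q u \<le> Q v * (\<Sum>y\<in>I. (u y)\<^sup>2)"
        by (rule homogeneous) (use v(1) that in \<open>simp add: u_def\<close>)
      ultimately show ?thesis by (simp add: algebra_simps power2_eq_square)
    qed
    show ?thesis
    proof (rule ccontr)
      assume "\<not> ?thesis"
      then have pos: "s - Q v * v x > 0" by (simp add: s_def)
      \<comment> \<open>A positive bound for the second-order coefficient. With \<open>t\<close>
        scaled by it, the second-order term is at most half of the first-order gain.\<close>
      define b where "b = \<bar>Q v - W x x\<bar> + 1"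
      define t where "t = (s - Q v * v x) / b"
      have b: "b > 0" "Q v - W x x < b" by (simp_all add: b_def)
      have t: "t > 0" using pos b by (simp add: t_def)
      have "t * (2 * (s - Q v * v x)) \<le> t * (t * (Q v - W x x))"
        using quad[OF t] by (simp add: algebra_simps power2_eq_square)
      then have "2 * (s - Q v * v x) \<le> t * (Q v - W x x)" using t by simp
      also have "\<dots> \<le> t * b" using t b by (intro mult_left_mono) auto
      also have "\<dots> = s - Q v * v x" using b by (simp add: t_def)
      finally show False using pos by simp
    qed
  qed
  show ?thesis by (rule that[of v "Q v"]) (use v le Q_alt in auto)
qed

lemma kernel_pos: "P \<in> kernels m E \<Longrightarrow> e \<in> E \<Longrightarrow> P e > 0"
  and kernel_zero: "P \<in> kernels m E \<Longrightarrow> e \<notin> E \<Longrightarrow> P e = 0"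
  and kernel_sum: "P \<in> kernels m E \<Longrightarrow> x \<in> {1..m} \<Longrightarrow> (\<Sum>y=1..m. P (x, y)) = 1"
  unfolding kernels_def by blast+

context reversible_graph
begin

text \<open>The maximizer satisfies \<open>W v\<close> \<le> \<open>l v\<close> pointwise, and
  pairing both sides with \<open>v\<close> gives the same value \<open>l\<close>. Once
  \<open>v\<close> is known to be positive, equality holds in every coordinate.\<close>

lemma Perron_vector:
  fixes W :: "nat \<Rightarrow> nat \<Rightarrow> real"
  assumes sym_W: "\<And>x y. W x y = W y x"
    and pos_W: "\<And>x y. (x, y) \<in> E \<Longrightarrow> W x y > 0" and zero_W: "\<And>x y. (x, y) \<notin> E \<Longrightarrow> W x y = 0"
  shows "\<exists>v l. l > 0 \<and> (\<forall>x\<in>{1..m}. v x > 0 \<and> (\<Sum>y=1..m. W x y * v y) = l * v x)"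
proof -
  have nonneg_W: "W x y \<ge> 0" for x y using pos_W[of x y] zero_W[of x y] by fastforce
  have "finite {1..m}" "{1..m} \<noteq> {}" using m_ge_2 by auto
  then obtain v l where v: "\<And>x. x \<in> {1..m} \<Longrightarrow> v x \<ge> 0" and norm_v: "(\<Sum>x=1..m. (v x)\<^sup>2) = 1"
    and l: "(\<Sum>x=1..m. v x * (\<Sum>y=1..m. W x y * v y)) = l"
    and le: "\<And>x. x \<in> {1..m} \<Longrightarrow> (\<Sum>y=1..m. W x y * v y) \<le> l * v x"
    using quadratic_form_maximizer[of "{1..m}" W] sym_W by blast
  have v_pos: "v x > 0" if x: "x \<in> {1..m}" for x
  proof (rule ccontr)
    assume "\<not> v x > 0"
    with v[OF x] have "v x = 0" by simp
    \<comment> \<open>At a zero \<open>y\<close> of \<open>v\<close> the nonnegative sum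
      \<open>W v\<close> is at most 0, so each neighbour is a zero too; zeros would spread to the
      whole graph.\<close>
    have closed: "z \<in> {1..m} \<and> v z = 0" if y: "y \<in> {1..m} \<and> v y = 0" and yz: "(y, z) \<in> E" for y z
    proof -
      have z: "z \<in> {1..m}" using edge_vertices[OF yz] by blast
      have "(\<Sum>z=1..m. W y z * v z) \<le> 0" using le[of y] y by simp
      moreover have "W y z * v z \<le> (\<Sum>z=1..m. W y z * v z)"
        by (rule member_le_sum[OF z]) (use nonneg_W v in auto)
      ultimately have "W y z * v z \<le> 0" by simp
      then have "v z \<le> 0" using pos_W[OF yz] by (simp add: mult_le_0_iff)
      then show ?thesis using v[OF z] z by simp
    qed
    have "v y = 0" if "y \<in> {1..m}" for y
      using closed_vertex_set[of x "{y. y \<in> {1..m} \<and> v y = 0}" y] x \<open>v x = 0\<close> that closed by blast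
    then show False using norm_v by simp
  qed
  define Wv where "Wv x = (\<Sum>y=1..m. W x y * v y)" for x
  have "(\<Sum>x=1..m. v x * (l * v x - Wv x)) = l * (\<Sum>x=1..m. (v x)\<^sup>2) - (\<Sum>x=1..m. v x * Wv x)"
    by (simp add: right_diff_distrib sum_subtractf sum_distrib_left power2_eq_square mult.left_commute)
  then have sum_0: "(\<Sum>x=1..m. v x * (l * v x - Wv x)) = 0" using norm_v l by (simp add: Wv_def)
  have "v x * (l * v x - Wv x) \<ge> 0" if "x \<in> {1..m}" for x
    using le[OF that] v[OF that] by (simp add: Wv_def)
  with sum_0 have terms_0: "\<forall>x\<in>{1..m}. v x * (l * v x - Wv x) = 0"
    by (subst (asm) sum_nonneg_eq_0_iff) simp_all
  have eq: "(\<Sum>y=1..m. W x y * v y) = l * v x" if "x \<in> {1..m}" for x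
  proof -
    have "v x * (l * v x - Wv x) = 0" using terms_0 that by blast
    then show ?thesis using v_pos[OF that] by (simp add: Wv_def)
  qed
  have one: "1 \<in> {1..m}" using m_ge_2 by simp
  obtain y where y: "(1, y) \<in> E" using neighbour[OF one] by blast
  have "0 < W 1 y * v y" using pos_W[OF y] v_pos edge_vertices[OF y] by simp
  also have "\<dots> \<le> (\<Sum>y=1..m. W 1 y * v y)"
    by (rule member_le_sum) (use edge_vertices[OF y] nonneg_W v in auto)
  also have "\<dots> = l * v 1" by (rule eq[OF one])
  finally have "l > 0" using v_pos[OF one] by (simp add: zero_less_mult_iff)
  then show ?thesis using v_pos eq by blast
qed

text \<open>The Doob transform by the Perron vector: it normalizes the rows and changes the
  logarithm only by the gradient of \<open>ln v\<close> and the constant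
  \<open>ln l\<close>.\<close>

lemma kernel_of_symmetric_weights:
  assumes S: "\<And>x y. S (x, y) = S (y, x)"
  obtains P r c where "P \<in> kernels m E"
    "\<And>x y. (x, y) \<in> E \<Longrightarrow> ln (P (x, y)) = S (x, y) + r y - r x - c"
proof -
  define W where "W x y = (if (x, y) \<in> E then exp (S (x, y)) else 0)" for x y
  have "\<exists>v l. l > 0 \<and> (\<forall>x\<in>{1..m}. v x > 0 \<and> (\<Sum>y=1..m. W x y * v y) = l * v x)"
  proof (rule Perron_vector)
    show "W x y = W y x" for x y using S[of x y] edge_sym by (auto simp: W_def)
  qed (simp_all add: W_def)
  then obtain v l where l: "l > 0" and v: "\<And>x. x \<in> {1..m} \<Longrightarrow> v x > 0"
    and eq: "\<And>x. x \<in> {1..m} \<Longrightarrow> (\<Sum>y=1..m. W x y * v y) = l * v x" by blast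
  define P where "P = (\<lambda>(x, y). W x y * v y / (l * v x))"
  have "(\<Sum>y=1..m. P (x, y)) = 1" if "x \<in> {1..m}" for x
    using eq[OF that] v[OF that] l by (simp add: P_def flip: sum_divide_distrib)
  then have "P \<in> kernels m E"
    using v l edge_vertices by (auto simp: kernels_def P_def W_def)
  moreover have "ln (P (x, y)) = S (x, y) + ln (v y) - ln (v x) - ln l" if xy: "(x, y) \<in> E" for x y
  proof -
    have "v x > 0" "v y > 0" using v edge_vertices[OF xy] by blast+
    then show ?thesis using xy l by (simp add: P_def W_def ln_mult ln_div)
  qed
  ultimately show ?thesis by (rule that)
qed

text \<open>
  The function \<open>u = exp r\<close> satisfies \<open>k u = P u\<close> for a constant \<open>k\<close>, so that the maximum principle
  applies to it: it forces \<open>k \<le> 1\<close> at a maximum and \<open>k \<ge> 1\<close> at a minimum of \<open>u\<close>.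
\<close>

lemma kernel_determined_up_to_gradient:
  assumes P: "P \<in> kernels m E" and P': "P' \<in> kernels m E"
    and ln_eq: "\<And>x y. (x, y) \<in> E \<Longrightarrow> ln (P' (x, y)) = ln (P (x, y)) + r y - r x + c"
  shows "P' = P"
proof -
  note pos = kernel_pos[OF P] and zero = kernel_zero[OF P] and sum = kernel_sum[OF P]
  note pos' = kernel_pos[OF P'] and zero' = kernel_zero[OF P'] and sum' = kernel_sum[OF P']
  have P'_eq: "P' (x, y) = P (x, y) * exp (r y - r x + c)" for x y
  proof (cases "(x, y) \<in> E")
    case True
    have "P' (x, y) = exp (ln (P' (x, y)))" using pos'[OF True] by simp
    also have "\<dots> = exp (ln (P (x, y)) + (r y - r x + c))" using ln_eq[OF True] by (simp add: algebra_simps)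
    also have "\<dots> = P (x, y) * exp (r y - r x + c)" using pos[OF True] by (simp add: exp_add)
    finally show ?thesis .
  qed (simp add: zero zero')
  \<comment> \<open>The difference of the row sums of \<open>P'\<close> and \<open>P\<close>, both
    equal to 1.\<close>
  have harmonic: "(\<Sum>y=1..m. P (x, y) * (exp (r y - r x + c) - 1)) = 0" if "x \<in> {1..m}" for x
    using sum[OF that] sum'[OF that] by (simp add: right_diff_distrib sum_subtractf flip: P'_eq)
  have fin: "finite (r ` {1..m})" "r ` {1..m} \<noteq> {}" using m_ge_2 by auto
  obtain a where a: "a \<in> {1..m}" "\<And>x. x \<in> {1..m} \<Longrightarrow> r x \<le> r a"
    using Max_in[OF fin] Max_ge[OF fin(1)] by (metis (no_types, lifting) imageE imageI)
  obtain b where b: "b \<in> {1..m}" "\<And>x. x \<in> {1..m} \<Longrightarrow> r b \<le> r x"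
    using Min_in[OF fin] Min_le[OF fin(1)] by (metis (no_types, lifting) imageE imageI)
  have P_nonneg: "P e \<ge> 0" for e using pos[of e] zero[of e] by fastforce
  have c_nonneg: "c \<ge> 0"
  proof (rule ccontr)
    assume "\<not> c \<ge> 0"
    \<comment> \<open>At the maximum \<open>a\<close> a negative \<open>c\<close> makes all factors
      negative, and some edge leaves \<open>a\<close>, so the sum could not be 0.\<close>
    then have neg: "exp (r y - r a + c) - 1 < 0" if "y \<in> {1..m}" for y using a(2)[OF that] by simp
    obtain y where y: "(a, y) \<in> E" using neighbour[OF a(1)] by blast
    have "(\<Sum>y=1..m. P (a, y) * (exp (r y - r a + c) - 1)) < (\<Sum>y=1..m. 0)"
    proof (rule sum_strict_mono_ex1)
      show "\<forall>y\<in>{1..m}. P (a, y) * (exp (r y - r a + c) - 1) \<le> 0"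
        using mult_nonneg_nonpos[OF P_nonneg less_imp_le[OF neg]] by blast
      show "\<exists>y\<in>{1..m}. P (a, y) * (exp (r y - r a + c) - 1) < 0"
        using edge_vertices[OF y] pos[OF y] neg by (intro bexI[of _ y]) (auto intro!: mult_pos_neg)
    qed simp
    then show False using harmonic[OF a(1)] by simp
  qed
  have nonneg: "exp (r y - r b + c) - 1 \<ge> 0" if "y \<in> {1..m}" for y
    using b(2)[OF that] c_nonneg by simp
  \<comment> \<open>At the minimum \<open>b\<close> all terms are nonnegative and sum to 0. Along an
    edge from \<open>b\<close>, the nonnegative numbers \<open>r y - r b\<close> and
    \<open>c\<close> then add up to 0, which gives \<open>c = 0\<close>.\<close>
  have "\<forall>y\<in>{1..m}. P (b, y) * (exp (r y - r b + c) - 1) = 0"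
    using harmonic[OF b(1)] P_nonneg nonneg by (subst (asm) sum_nonneg_eq_0_iff) auto
  then have min_edge: "r y - r b + c = 0" if "(b, y) \<in> E" for y
    using pos[OF that] edge_vertices[OF that] by fastforce
  obtain y where "(b, y) \<in> E" using neighbour[OF b(1)] by blast
  then have c: "c = 0" using min_edge[of y] c_nonneg b(2)[of y] edge_vertices[of b y] by simp
  \<comment> \<open>The same argument at any minimizer spreads the minimal value along edges, so
    \<open>r\<close> is constant.\<close>
  have closed: "r z = r b" if y: "y \<in> {1..m}" "r y = r b" and yz: "(y, z) \<in> E" for y z
  proof -
    have "\<forall>z\<in>{1..m}. P (y, z) * (exp (r z - r y + c) - 1) = 0"
      using harmonic[OF y(1)] P_nonneg nonneg unfolding y(2)
      by (subst (asm) sum_nonneg_eq_0_iff) auto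
    then show ?thesis using pos[OF yz] edge_vertices[OF yz] c y(2) by fastforce
  qed
  have const: "r x = r b" if "x \<in> {1..m}" for x
    using closed_vertex_set[of b "{x. x \<in> {1..m} \<and> r x = r b}" x] b(1) that closed edge_vertices by blast
  have "P' (x, y) = P (x, y)" for x y
  proof (cases "(x, y) \<in> E")
    case True
    then show ?thesis using const edge_vertices[OF True] by (simp add: P'_eq c)
  qed (simp add: zero zero')
  then show ?thesis by auto
qed

text \<open>In the difference of \<open>ln P\<close> over an edge and its reverse, \<open>S\<close>
  and \<open>c\<close> cancel and the gradient of \<open>2 r\<close> remains, so
  \<open>exp (2 r)\<close> is in detailed balance.\<close>

lemma rev_kernelsI:
  assumes P: "P \<in> kernels m E" and S: "\<And>x y. S (x, y) = S (y, x)"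
    and ln_P: "\<And>x y. (x, y) \<in> E \<Longrightarrow> ln (P (x, y)) = S (x, y) + r y - r x - c"
  shows "P \<in> rev_kernels m E"
proof -
  note pos = kernel_pos[OF P] and zero = kernel_zero[OF P] and sum = kernel_sum[OF P]
  have balance: "exp (2 * r x) * P (x, y) = exp (2 * r y) * P (y, x)" for x y
  proof (cases "(x, y) \<in> E")
    case True
    have "exp (2 * r x) * P (x, y) = exp (2 * r x + ln (P (x, y)))"
      using pos[OF True] by (simp add: exp_add)
    also have "2 * r x + ln (P (x, y)) = 2 * r y + ln (P (y, x))"
      using ln_P[OF True] ln_P[OF edge_sym[OF True]] S[of x y] by simp
    also have "exp \<dots> = exp (2 * r y) * P (y, x)"
      using pos[OF edge_sym[OF True]] by (simp add: exp_add)
    finally show ?thesis .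
  next
    case False
    then have "(y, x) \<notin> E" using edge_sym by blast
    with False show ?thesis by (simp add: zero)
  qed
  define Z where "Z = (\<Sum>x=1..m. exp (2 * r x))"
  have Z: "Z > 0" unfolding Z_def using m_ge_2 by (intro sum_pos) auto
  define p where "p x = exp (2 * r x) / Z" for x
  have detailed: "p x * P (x, y) = p y * P (y, x)" for x y
    using balance[of x y] by (simp add: p_def)
  have "stationary_distribution m P p" unfolding stationary_distribution_def
  proof (intro conjI ballI)
    show "(\<Sum>x=1..m. p x) = 1" using Z by (simp add: p_def Z_def flip: sum_divide_distrib)
    show "p x \<ge> 0" for x using Z by (simp add: p_def)
    fix y assume y: "y \<in> {1..m}"
    \<comment> \<open>Detailed balance summed over \<open>x\<close> yields stationarity, as rows sum
      to 1.\<close>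
    have "(\<Sum>x=1..m. p x * P (x, y)) = (\<Sum>x=1..m. p y * P (y, x))"
      by (rule sum.cong[OF refl detailed])
    then show "(\<Sum>x=1..m. p x * P (x, y)) = p y" using sum[OF y] by (simp flip: sum_distrib_left)
  qed
  then show ?thesis using P detailed by (auto simp: rev_kernels_def)
qed

lemma rev_kernelsE:
  assumes "P \<in> rev_kernels m E"
  obtains S r where "\<And>x y. (x, y) \<in> E \<Longrightarrow> S (x, y) = S (y, x)"
    "\<And>x y. (x, y) \<in> E \<Longrightarrow> ln (P (x, y)) = S (x, y) + r y - r x"
proof -
  obtain p where P: "P \<in> kernels m E" and p: "stationary_distribution m P p"
    and balance: "\<And>x y. x \<in> {1..m} \<Longrightarrow> y \<in> {1..m} \<Longrightarrow> p x * P (x, y) = p y * P (y, x)"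
    using assms unfolding rev_kernels_def by blast
  note pos = kernel_pos[OF P]
  have p_nonneg: "p x \<ge> 0" if "x \<in> {1..m}" for x
    using p that by (simp add: stationary_distribution_def)
  have p_pos: "p x > 0" if x: "x \<in> {1..m}" for x
  proof (rule ccontr)
    assume "\<not> p x > 0"
    with p_nonneg[OF x] have "p x = 0" by simp
    \<comment> \<open>Detailed balance passes a zero of \<open>p\<close> to every neighbour, since
      the reverse edge has positive probability.\<close>
    have closed: "z \<in> {1..m} \<and> p z = 0" if y: "y \<in> {1..m} \<and> p y = 0" and yz: "(y, z) \<in> E" for y z
      using balance[of y z] y edge_vertices[OF yz] pos[OF edge_sym[OF yz]] by simp
    have "p y = 0" if "y \<in> {1..m}" for y
      using closed_vertex_set[of x "{y. y \<in> {1..m} \<and> p y = 0}" y] x \<open>p x = 0\<close> that closed by blast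
    then show False using p by (simp add: stationary_distribution_def)
  qed
  \<comment> \<open>The logarithm of detailed balance has antisymmetric difference
    \<open>ln (p y) - ln (p x)\<close>; one half of it goes to each direction.\<close>
  define r where "r x = ln (p x) / 2" for x
  define S where "S = (\<lambda>(x, y). ln (P (x, y)) + r x - r y)"
  have "S (x, y) = S (y, x)" if "(x, y) \<in> E" for x y
  proof -
    have xy: "x \<in> {1..m}" "y \<in> {1..m}" using edge_vertices[OF that] by auto
    have "ln (p x) + ln (P (x, y)) = ln (p y) + ln (P (y, x))"
      using arg_cong[OF balance[OF xy], of ln] p_pos[OF xy(1)] p_pos[OF xy(2)] pos[OF that] pos[OF edge_sym[OF that]]
      by (simp add: ln_mult)
    then show ?thesis by (simp add: S_def r_def field_simps)
  qed
  moreover have "ln (P (x, y)) = S (x, y) + r y - r x" for x y by (simp add: S_def)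
  ultimately show ?thesis by (rule that)
qed

end

subsection \<open>The exponential family of reversible kernels\<close>

context reversible_graph
begin

lemma e_family_rev_kernels: "e_family m E (rev_kernels m E) d"
proof -
  define tilt where "tilt a P r c \<longleftrightarrow> P \<in> kernels m E \<and>
    (\<forall>(x, y)\<in>E. ln (P (x, y)) = comb a (x, y) + r y - r x - c)" for a P r c
  have "\<exists>P r c. tilt a P r c" for a
  proof -
    obtain P r c where "P \<in> kernels m E"
      "\<And>x y. (x, y) \<in> E \<Longrightarrow> ln (P (x, y)) = comb a (x, y) + r y - r x - c"
      using kernel_of_symmetric_weights[of "comb a", OF comb_commute] by blast
    then show ?thesis unfolding tilt_def by blast
  qed
  \<comment> \<open>A kernel is chosen for every sequence; only those in \<real>^d will be
    used.\<close>
  then obtain P R \<psi> where tilt: "\<And>a. tilt a (P a) (R a) (\<psi> a)" by metis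
  have ln_P: "ln (P a (x, y)) = comb a (x, y) + R a y - R a x - \<psi> a" if "(x, y) \<in> E" for a x y
    using tilt[of a] that unfolding tilt_def by blast
  have P_kernel: "P a \<in> kernels m E" for a using tilt[of a] by (simp add: tilt_def)
  let ?\<Theta> = "topspace (Euclidean_space d)"
  have "rev_kernels m E = P ` ?\<Theta>"
  proof (intro equalityI subsetI)
    fix P' assume P': "P' \<in> rev_kernels m E"
    then have P'_kernel: "P' \<in> kernels m E" by (simp add: rev_kernels_def)
    obtain S r where S: "\<And>x y. (x, y) \<in> E \<Longrightarrow> S (x, y) = S (y, x)"
      and ln_P': "\<And>x y. (x, y) \<in> E \<Longrightarrow> ln (P' (x, y)) = S (x, y) + r y - r x"
      using P' by (rule rev_kernelsE) blast
    \<comment> \<open>The coefficients of \<open>symmetric_expansion\<close>, cut off at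
      \<open>d\<close> to be a point of \<open>Euclidean_space d\<close>.\<close>
    define a where "a j = (if j < d then S (T_enum j) - S (m, x_star m E) else 0)" for j
    have "comb a e = comb (\<lambda>j. S (T_enum j) - S (m, x_star m E)) e" for e
      unfolding comb_def by (intro sum.cong) (simp_all add: a_def)
    then have comb_a: "comb a e = S e - S (m, x_star m E)" if "e \<in> E" for e
      using symmetric_expansion[of S, OF S that] by simp
    \<comment> \<open>Both logarithms have the same symmetric part up to a constant, so uniqueness
      identifies the kernels.\<close>
    have "ln (P' (x, y)) = ln (P a (x, y)) + (r y - R a y) - (r x - R a x) + (S (m, x_star m E) + \<psi> a)"
      if "(x, y) \<in> E" for x y
      using ln_P'[OF that] ln_P[OF that, of a] comb_a[OF that] by simp
    from kernel_determined_up_to_gradient[OF P_kernel P'_kernel this] have "P' = P a" .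
    moreover have "a \<in> ?\<Theta>" by (simp add: a_def topspace_Euclidean_space)
    ultimately show "P' \<in> P ` ?\<Theta>" by (rule image_eqI)
  next
    fix P' assume "P' \<in> P ` ?\<Theta>"
    then obtain a where "P' = P a" by blast
    then show "P' \<in> rev_kernels m E"
      using rev_kernelsI[of "P a" "comb a" "R a" "\<psi> a", OF P_kernel comb_commute ln_P] by simp
  qed
  moreover have "connectedin (Euclidean_space d) ?\<Theta>"
    by (simp add: connectedin_topspace connected_Euclidean_space)
  moreover have "\<exists>r>0. {\<theta> \<in> ?\<Theta>. L2_set \<theta> {..<d} < r} \<subseteq> ?\<Theta>"
    by (rule exI[of _ 1]) auto
  \<comment> \<open>The base function \<open>K\<close> is 0, so the logarithm of the kernel at the
    origin is itself null on the edges.\<close>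
  moreover have "\<forall>\<theta>\<in>?\<Theta>.
      (\<forall>(x, x')\<in>E. ln (P \<theta> (x, x')) =
         (\<lambda>_. 0) (x, x') + (\<Sum>i<d. \<theta> i * g i (x, x')) + R \<theta> x' - R \<theta> x - \<psi> \<theta>) \<and>
      (\<forall>e. e \<notin> E \<longrightarrow> P \<theta> e = 0)"
    using ln_P kernel_zero[OF P_kernel] unfolding comb_def by auto
  moreover have "rev_kernels m E \<subseteq> kernels m E" by (auto simp: rev_kernels_def)
  moreover note lin_indep_g
  ultimately show ?thesis unfolding e_family_def
    by (intro conjI exI[of _ ?\<Theta>] exI[of _ P] exI[of _ "\<lambda>_. 0"] exI[of _ g] exI[of _ R] exI[of _ \<psi>])
qed

end

theorem theorem5p1:
  fixes m :: nat and E :: "(nat \<times> nat) set"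
  assumes "m \<ge> 2"
    and "strongly_connected_digraph m E"
    and "sym E"
  shows "(VectorSpace.subspace class_ring (null_funs E) (fun_space (rev_funs E)) \<and>
          vectorspace class_ring (G_rev E) \<and>
          vectorspace.fin_dim class_ring (G_rev E) \<and>
          vectorspace.dim class_ring (G_rev E) = card (T_set m E)) \<and>
         e_family m E (rev_kernels m E) (card (T_set m E))"
proof -
  interpret reversible_graph m E using assms by unfold_locales
  show ?thesis
    using subspace_null_funs G_rev_dim e_family_rev_kernels unfolding d_def by blast
qed

end
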